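(* Consider a system with $2f_s+1$ servers, of which at most $f_s$ are Byzantine, and $f_r+1$ storage replicas, of which at most $f_r$ are Byzantine, running the storage and proof protocol described in the context. For any pair $(\mathrm{tag}, v)$, if there exists a valid Proof of Availability and Integrity $P(\mathrm{tag}, v)$, then (i) $\mathrm{locally\_valid}(\mathrm{tag}, v)$ holds for at least one correct server, and (ii) eventually $v$ is available from the distributed storage, i.e. there is a time after which every operation $\mathrm{get}(P(\mathrm{tag},v))$ invoked by a correct process terminates and returns $v$.
   Context: Processes. The system is a finite set of message-passing processes: clients, a set $S$ of $2f_s+1$ servers, a set $R$ of $f_r+1$ storage replicas, and a model owner. Byzantine processes behave arbitrarily; the other processes are correct and follow the protocol. At most $f_s$ servers and at most $f_r$ replicas are Byzantine. Messages are signed by their sender and signatures cannot be forged. Communication is reliable: if a correct process $p$ sends a message to a correct process $q$, then $q$ eventually receives it (no bound on delays). Hash. $h$ is a cryptographic hash function, idealized as collision-free: no process can produce $v \neq v'$ with $h(v)=h(v')$. Local validity. Each value $v$ handled by the protocol (a client update, an aggregated model, a set of selected clients) carries a tag giving its type. $\mathrm{locally\_valid}(\mathrm{tag}, v)$ is a boolean check evaluated locally by each server, returning true if $v$ passes the computational-integrity check relative to tag; its result may differ between correct servers. Proof of Availability and Integrity. A (valid) $P(\mathrm{tag},v)$ is a set of signatures on the hash-key $h(v)$ (relative to tag) by $f_s+1$ distinct servers. A correct server signs $h(v)$ relative to tag only if $\mathrm{locally\_valid}(\mathrm{tag},v)$ holds at that server, and only after storing $v$ in the key-value store, i.e. after sending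 $\langle h(v), v\rangle$ to all replicas $r\in R$. Storage replica. Upon receiving a pair $\langle k, v\rangle$, a correct replica checks that $k = h(v)$; if so it stores $v$ under the hash-key $k$ forever, otherwise it rejects the pair. Upon receiving a query for hash-key $k$, a correct replica that stores a value under $k$ replies with that value. Reading. The operation $\mathrm{get}(P(\mathrm{tag},v))$ first verifies that $h(v)$ is signed by $f_s+1$ distinct servers; it then sends a query for $h(v)$ to all replicas, waits until it receives a reply $\ell'$ with $h(\ell') = h(v)$, and returns $\ell'$. *)

theory Defs
  imports Main
begin

text \<open>
  Executions are infinite interleavings \<open>run :: nat \<Rightarrow> event\<close>; position in the sequence plays the
  role of time, and there is no bound on message delays.  The behaviour of correct processes is
  described by conditions on their events; the events of Byzantine processes are constrained only
  by the cryptographic assumptions.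
\<close>

record ('p, 'tag, 'k, 'v) system =
  clients :: "'p set"
  servers :: "'p set"
  replicas :: "'p set"
  owner :: 'p
  byzantine :: "'p set"
  f_s :: nat
  f_r :: nat
  hash :: "'v \<Rightarrow> 'k"
  locally_valid :: "'p \<Rightarrow> 'tag \<Rightarrow> 'v \<Rightarrow> bool"

definition processes :: "('p, 'tag, 'k, 'v) system \<Rightarrow> 'p set" where
  "processes sys = clients sys \<union> servers sys \<union> replicas sys \<union> {owner sys}"

definition correct :: "('p, 'tag, 'k, 'v) system \<Rightarrow> 'p \<Rightarrow> bool" where
  "correct sys p \<longleftrightarrow> p \<in> processes sys \<and> p \<notin> byzantine sys"

text \<open>Collision freedom of the hash function is idealized as injectivity.\<close>

definition wf_system :: "('p, 'tag, 'k, 'v) system \<Rightarrow> bool" where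
  "wf_system sys \<longleftrightarrow>
     finite (processes sys) \<and>
     byzantine sys \<subseteq> processes sys \<and>
     card (servers sys) = 2 * f_s sys + 1 \<and>
     card (replicas sys) = f_r sys + 1 \<and>
     card (servers sys \<inter> byzantine sys) \<le> f_s sys \<and>
     card (replicas sys \<inter> byzantine sys) \<le> f_r sys \<and>
     inj (hash sys)"

datatype ('p, 'tag, 'k) signature =
  Signature (signer: 'p) (sig_tag: 'tag) (sig_key: 'k)

text \<open>
  \<open>Other\<close> messages are those of the rest of the protocol (client updates, signature shares,
  proofs, \<dots>); their contents are irrelevant here.
\<close>

datatype ('k, 'v, 'm) msg =
    Store 'k 'v
  | Query 'k
  | Reply 'v
  | Other 'm

text \<open>
  \<open>Receive q p m\<close>: process \<open>q\<close> receives \<open>m\<close> carrying the message signature of \<open>p\<close>.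
  \<open>Sign p \<sigma>\<close>: process \<open>p\<close> computes the signature \<open>\<sigma>\<close>; the signer named in \<open>\<sigma>\<close> may differ from \<open>p\<close>,
  as Byzantine processes can share their signing keys.
  \<open>Invoke p P\<close> starts an operation \<open>get(P)\<close> at \<open>p\<close>.  An operation is identified by its process and
  the position \<open>i\<close> of its invocation, so \<open>Return p i v\<close> says that the operation invoked
  by \<open>p\<close> at time \<open>i\<close> terminates and returns \<open>v\<close>.
  \<open>Internal\<close> is any step without effect on the above.
\<close>

datatype ('p, 'tag, 'k, 'v, 'm) event =
    Send 'p 'p "('k, 'v, 'm) msg"
  | Receive 'p 'p "('k, 'v, 'm) msg"
  | Sign 'p "('p, 'tag, 'k) signature"
  | Invoke 'p "('p, 'tag, 'k) signature set"
  | Return 'p nat 'v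
  | Internal

type_synonym ('p, 'tag, 'k, 'v, 'm) run = "nat \<Rightarrow> ('p, 'tag, 'k, 'v, 'm) event"

text \<open>
  \<open>P\<close> is, at time \<open>t\<close>, a set of genuine signatures on the hash-key \<open>k\<close> relative to \<open>tag\<close> by
  \<open>f_s + 1\<close> distinct servers.  Since elements of type \<open>signature\<close> can be written down freely,
  being genuine is expressed by having been computed by some process before \<open>t\<close>.
\<close>

definition signed_by_quorum ::
  "('p, 'tag, 'k, 'v) system \<Rightarrow> ('p, 'tag, 'k, 'v, 'm) run \<Rightarrow> nat \<Rightarrow> 'tag \<Rightarrow> 'k
     \<Rightarrow> ('p, 'tag, 'k) signature set \<Rightarrow> bool" where
  "signed_by_quorum sys run t tag k P \<longleftrightarrow>
     (\<forall>\<sigma>\<in>P. signer \<sigma> \<in> servers sys \<and> sig_tag \<sigma> = tag \<and> sig_key \<sigma> = k \<and>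
            (\<exists>t'<t. \<exists>p. run t' = Sign p \<sigma>)) \<and>
     card (signer ` P) = f_s sys + 1"

definition valid_proof ::
  "('p, 'tag, 'k, 'v) system \<Rightarrow> ('p, 'tag, 'k, 'v, 'm) run \<Rightarrow> nat \<Rightarrow> 'tag \<Rightarrow> 'v
     \<Rightarrow> ('p, 'tag, 'k) signature set \<Rightarrow> bool" where
  "valid_proof sys run t tag v P \<longleftrightarrow> signed_by_quorum sys run t tag (hash sys v) P"

text \<open>
  A signed message may be relayed, so a message received as signed by a correct \<open>p\<close> need only
  have been sent by \<open>p\<close> to some process.
\<close>

definition unforgeable ::
  "('p, 'tag, 'k, 'v) system \<Rightarrow> ('p, 'tag, 'k, 'v, 'm) run \<Rightarrow> bool" where
  "unforgeable sys run \<longleftrightarrow>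
     (\<forall>t p q m. run t = Receive q p m \<and> correct sys p \<longrightarrow>
        (\<exists>t'<t. \<exists>q'. run t' = Send p q' m)) \<and>
     (\<forall>t p \<sigma>. run t = Sign p \<sigma> \<and> correct sys (signer \<sigma>) \<longrightarrow> p = signer \<sigma>)"

definition reliable ::
  "('p, 'tag, 'k, 'v) system \<Rightarrow> ('p, 'tag, 'k, 'v, 'm) run \<Rightarrow> bool" where
  "reliable sys run \<longleftrightarrow>
     (\<forall>t p q m. run t = Send p q m \<and> correct sys p \<and> correct sys q \<longrightarrow>
        (\<exists>t'>t. run t' = Receive q p m))"

definition server_protocol ::
  "('p, 'tag, 'k, 'v) system \<Rightarrow> ('p, 'tag, 'k, 'v, 'm) run \<Rightarrow> 'p \<Rightarrow> bool" where
  "server_protocol sys run s \<longleftrightarrow>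
     (\<forall>t tag k. run t = Sign s (Signature s tag k) \<longrightarrow>
        (\<exists>v. k = hash sys v \<and> locally_valid sys s tag v \<and>
             (\<forall>r\<in>replicas sys. \<exists>t'<t. run t' = Send s r (Store (hash sys v) v))))"

text \<open>
  Contents of the key-value store of a correct replica \<open>r\<close> just before the event at time \<open>t\<close>.
\<close>

primrec store ::
  "('p, 'tag, 'k, 'v) system \<Rightarrow> ('p, 'tag, 'k, 'v, 'm) run \<Rightarrow> 'p \<Rightarrow> nat \<Rightarrow> 'k \<Rightarrow> 'v option" where
  "store sys run r 0 = Map.empty"
| "store sys run r (Suc t) =
     (case run t of
        Receive r' p m \<Rightarrow>
          (case m of
             Store k v \<Rightarrow>
               if r' = r \<and> k = hash sys v then (store sys run r t)(k \<mapsto> v) else store sys run r t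
           | _ \<Rightarrow> store sys run r t)
      | _ \<Rightarrow> store sys run r t)"

definition replica_protocol ::
  "('p, 'tag, 'k, 'v) system \<Rightarrow> ('p, 'tag, 'k, 'v, 'm) run \<Rightarrow> 'p \<Rightarrow> bool" where
  "replica_protocol sys run r \<longleftrightarrow>
     (\<forall>t q k v. run t = Receive r q (Query k) \<and> store sys run r t k = Some v \<longrightarrow>
        (\<exists>t'>t. run t' = Send r q (Reply v)))"

text \<open>
  \<open>matching_reply sys run p i j k v\<close>: at time \<open>j\<close>, after the invocation at time \<open>i\<close>, process \<open>p\<close>
  receives from a replica the reply \<open>v\<close>, whose hash is \<open>k\<close>.
\<close>

definition matching_reply ::
  "('p, 'tag, 'k, 'v) system \<Rightarrow> ('p, 'tag, 'k, 'v, 'm) run \<Rightarrow> 'p \<Rightarrow> nat \<Rightarrow> nat \<Rightarrow> 'k \<Rightarrow> 'v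
     \<Rightarrow> bool" where
  "matching_reply sys run p i j k v \<longleftrightarrow>
     i < j \<and> (\<exists>r\<in>replicas sys. run j = Receive p r (Reply v)) \<and> hash sys v = k"

text \<open>
  The first condition says what happens once verification succeeds: queries are sent to all
  replicas, and the operation terminates if some matching reply arrives.  The second says that it
  returns nothing but a matching reply to a verified proof.
\<close>

definition get_protocol ::
  "('p, 'tag, 'k, 'v) system \<Rightarrow> ('p, 'tag, 'k, 'v, 'm) run \<Rightarrow> 'p \<Rightarrow> bool" where
  "get_protocol sys run p \<longleftrightarrow>
     (\<forall>i P tag k. run i = Invoke p P \<and> signed_by_quorum sys run i tag k P \<longrightarrow>
        (\<forall>r\<in>replicas sys. \<exists>j>i. run j = Send p r (Query k)) \<and>
        ((\<exists>j v. matching_reply sys run p i j k v) \<longrightarrow> (\<exists>j v. run j = Return p i v))) \<and>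
     (\<forall>i j v. run j = Return p i v \<longrightarrow>
        (\<exists>P tag k j'. run i = Invoke p P \<and> signed_by_quorum sys run i tag k P \<and>
           j' < j \<and> matching_reply sys run p i j' k v))"

definition valid_run ::
  "('p, 'tag, 'k, 'v) system \<Rightarrow> ('p, 'tag, 'k, 'v, 'm) run \<Rightarrow> bool" where
  "valid_run sys run \<longleftrightarrow>
     unforgeable sys run \<and> reliable sys run \<and>
     (\<forall>s\<in>servers sys. correct sys s \<longrightarrow> server_protocol sys run s) \<and>
     (\<forall>r\<in>replicas sys. correct sys r \<longrightarrow> replica_protocol sys run r) \<and>
     (\<forall>p. correct sys p \<longrightarrow> get_protocol sys run p)"

definition get_returns ::
  "('p, 'tag, 'k, 'v, 'm) run \<Rightarrow> 'p \<Rightarrow> nat \<Rightarrow> 'v \<Rightarrow> bool" where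
  "get_returns run p i v \<longleftrightarrow>
     (\<exists>j>i. run j = Return p i v) \<and> (\<forall>j v'. run j = Return p i v' \<longrightarrow> v' = v)"

definition eventually_available ::
  "('p, 'tag, 'k, 'v) system \<Rightarrow> ('p, 'tag, 'k, 'v, 'm) run \<Rightarrow> 'tag \<Rightarrow> 'v \<Rightarrow> bool" where
  "eventually_available sys run tag v \<longleftrightarrow>
     (\<exists>T. \<forall>i\<ge>T. \<forall>p P. correct sys p \<and> run i = Invoke p P \<and> valid_proof sys run i tag v P \<longrightarrow>
        get_returns run p i v)"

end

theory Submission
  imports Defs
begin

text \<open>Counting gives a correct process among the \<open>f_s + 1\<close> signers and another
  among the \<open>f_r + 1\<close> replicas. By unforgeability the correct signer really signed
  (\<open>quorum_has_correct_signer\<close>), so it found the value locally valid and had sent it to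
  every replica; collision freedom makes that value \<open>v\<close>. Reliable delivery brings it to
  the correct replica, which holds \<open>v\<close> from then on
  (\<open>store_after_receive\<close>). A get invoked later queries this replica, whose reply forces
  termination; any accepted reply, even a Byzantine one, has the hash of \<open>v\<close> and so is
  \<open>v\<close> (\<open>get_returns_if_stored\<close>).\<close>

lemma correct_member_exceeding_byzantine:
  assumes "Q \<subseteq> processes sys"
    and "card (Q \<inter> byzantine sys) < card Q"
  obtains p where "p \<in> Q" and "correct sys p"
proof -
  have "Q \<inter> byzantine sys \<noteq> Q"
    using assms(2) by auto
  then show thesis
    using assms(1) that unfolding correct_def by blast
qed

lemma correct_replica_exists:
  assumes "wf_system sys"
  obtains r where "r \<in> replicas sys" and "correct sys r"
proof (rule correct_member_exceeding_byzantine)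
  show "replicas sys \<subseteq> processes sys"
    by (auto simp: processes_def)
  show "card (replicas sys \<inter> byzantine sys) < card (replicas sys)"
    using assms by (auto simp: wf_system_def)
qed

lemma quorum_has_correct_signer:
  assumes wf: "wf_system sys" and "valid_run sys run"
    and quorum: "signed_by_quorum sys run t tag k P"
  obtains s t' where "s \<in> servers sys" and "correct sys s" and "run t' = Sign s (Signature s tag k)"
proof -
  have servers: "signer ` P \<subseteq> servers sys"
    using quorum by (auto simp: signed_by_quorum_def)
  then have subset: "signer ` P \<subseteq> processes sys"
    by (auto simp: processes_def)
  have "finite (servers sys \<inter> byzantine sys)"
    using wf by (simp add: wf_system_def processes_def)
  then have "card (signer ` P \<inter> byzantine sys) \<le> card (servers sys \<inter> byzantine sys)"
    using servers by (intro card_mono) auto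
  also have "\<dots> < card (signer ` P)"
    using wf quorum by (simp add: wf_system_def signed_by_quorum_def)
  finally obtain s where s: "s \<in> signer ` P" "correct sys s"
    using correct_member_exceeding_byzantine[OF subset] by blast
  then obtain \<sigma> where \<sigma>: "\<sigma> \<in> P" "signer \<sigma> = s"
    by blast
  then obtain t' p where sign: "run t' = Sign p \<sigma>"
    using quorum by (auto simp: signed_by_quorum_def)
  have "\<sigma> = Signature s tag k"
    using \<sigma> quorum by (cases \<sigma>) (auto simp: signed_by_quorum_def)
  \<comment> \<open>Genuineness only says that some process computed the signature; unforgeability
    makes it the correct signer itself.\<close>
  moreover have "p = s"
    using assms(2) sign s(2) \<sigma>(2) by (auto simp: valid_run_def unforgeable_def)
  ultimately show thesis
    using that s servers sign by blast
qed

text \<open>A quorum has \<open>f_s + 1 > 0\<close> signers, so \<open>P\<close> contains a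
  signature, and that signature carries the key. This ties the key checked by a returning get to the
  hash of \<open>v\<close>.\<close>

lemma signed_by_quorum_key_unique:
  assumes "signed_by_quorum sys run t tag k P" and "signed_by_quorum sys run t' tag' k' P"
  shows "k = k'"
proof -
  obtain \<sigma> where "\<sigma> \<in> P"
    using assms(1) by (fastforce simp: signed_by_quorum_def)
  then have "sig_key \<sigma> = k" and "sig_key \<sigma> = k'"
    using assms by (simp_all add: signed_by_quorum_def)
  then show ?thesis
    by simp
qed

lemma store_hash: "store sys run r t k = Some v \<Longrightarrow> hash sys v = k"
  by (induction t) (auto split: event.splits msg.splits if_splits)

text \<open>Entries are never deleted. Only definedness is tracked here; which value is stored
  follows from \<open>store_hash\<close> and injectivity.\<close>

lemma store_persistent:
  assumes "store sys run r t k \<noteq> None" and "t \<le> t'"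
  shows "store sys run r t' k \<noteq> None"
  using assms(2,1) by (induction rule: dec_induct) (auto split: event.splits msg.splits)

text \<open>A later \<open>Store\<close> may overwrite the entry under \<open>hash sys v\<close>, but by injectivity only with \<open>v\<close>.\<close>

lemma store_after_receive:
  assumes "inj (hash sys)" and "run t = Receive r p (Store (hash sys v) v)" and "t < t'"
  shows "store sys run r t' (hash sys v) = Some v"
proof -
  have "store sys run r (Suc t) (hash sys v) \<noteq> None"
    using assms(2) by simp
  then obtain w where "store sys run r t' (hash sys v) = Some w"
    using store_persistent assms(3) by (metis Suc_leI not_None_eq)
  then show ?thesis
    using store_hash assms(1) by (metis injD)
qed

lemma get_returns_if_stored:
  assumes wf: "wf_system sys" and vr: "valid_run sys run"
    and r: "r \<in> replicas sys" "correct sys r" and p: "correct sys p"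
    and stored: "\<And>t. i \<le> t \<Longrightarrow> store sys run r t (hash sys v) = Some v"
    and inv: "run i = Invoke p P" and vp: "valid_proof sys run i tag v P"
  shows "get_returns run p i v"
proof -
  have quorum: "signed_by_quorum sys run i tag (hash sys v) P"
    using vp by (simp add: valid_proof_def)
  have rel: "\<exists>t'>t. run t' = Receive q a m"
    if "run t = Send a q m" "correct sys a" "correct sys q" for t a q m
    using vr that unfolding valid_run_def reliable_def by blast
  have gp: "get_protocol sys run p"
    using vr p by (simp add: valid_run_def)
  obtain j where j: "j > i" "run j = Send p r (Query (hash sys v))"
    using gp inv quorum r(1) unfolding get_protocol_def by blast
  obtain j1 where j1: "j1 > j" "run j1 = Receive r p (Query (hash sys v))"
    using rel[OF j(2) p r(2)] by blast
  have "store sys run r j1 (hash sys v) = Some v"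
    using stored j(1) j1(1) by simp
  moreover have "replica_protocol sys run r"
    using vr r by (simp add: valid_run_def)
  ultimately obtain j2 where j2: "j2 > j1" "run j2 = Send r p (Reply v)"
    using j1(2) unfolding replica_protocol_def by blast
  obtain j3 where j3: "j3 > j2" "run j3 = Receive p r (Reply v)"
    using rel[OF j2(2) r(2) p] by blast
  have "matching_reply sys run p i j3 (hash sys v) v"
    using j j1 j2 j3 r(1) by (auto simp: matching_reply_def)
  \<comment> \<open>The operation may end on a reply from another replica, so nothing is known of
    \<open>v4\<close> yet.\<close>
  then obtain j4 v4 where ret: "run j4 = Return p i v4"
    using gp inv quorum unfolding get_protocol_def by blast
  \<comment> \<open>Safety, whoever replied: a returned value matches the key of the verified proof,
    and its reply came after the invocation.\<close>
  have only: "i < j' \<and> v' = v" if ret': "run j' = Return p i v'" for j' v'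
  proof -
    obtain P' tag' k' j'' where *: "run i = Invoke p P'" "signed_by_quorum sys run i tag' k' P'"
        "j'' < j'" "matching_reply sys run p i j'' k' v'"
      using gp ret' unfolding get_protocol_def by blast
    have "P' = P"
      using *(1) inv by simp
    then have "k' = hash sys v"
      using *(2) quorum by (metis signed_by_quorum_key_unique)
    then show ?thesis
      using *(3,4) injD[of "hash sys" v' v] wf by (simp add: matching_reply_def wf_system_def)
  qed
  then show ?thesis
    using ret unfolding get_returns_def by blast
qed

theorem lemma1:
  fixes sys :: "('p, 'tag, 'k, 'v) system"
    and run :: "('p, 'tag, 'k, 'v, 'm) run"
    and tag :: 'tag and v :: 'v
  assumes "wf_system sys"
    and "valid_run sys run"
    and "\<exists>t P. valid_proof sys run t tag v P"
  shows "(\<exists>s\<in>servers sys. correct sys s \<and> locally_valid sys s tag v) \<and>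
         eventually_available sys run tag v"
proof -
  have inj: "inj (hash sys)"
    using assms(1) by (simp add: wf_system_def)
  obtain s t where s: "s \<in> servers sys" "correct sys s"
      and sign: "run t = Sign s (Signature s tag (hash sys v))"
    using assms quorum_has_correct_signer unfolding valid_proof_def by metis
  have "server_protocol sys run s"
    using assms(2) s by (simp add: valid_run_def)
  then obtain v' where v': "hash sys v = hash sys v'" "locally_valid sys s tag v'"
      "\<forall>r\<in>replicas sys. \<exists>t'<t. run t' = Send s r (Store (hash sys v') v')"
    using sign unfolding server_protocol_def by blast
  \<comment> \<open>The signature mentions only the key, so the server protocol yields merely some
    preimage of it.\<close>
  have "v' = v"
    using v'(1) inj by (auto dest: injD)
  with v' have valid: "locally_valid sys s tag v"
      and sent: "\<forall>r\<in>replicas sys. \<exists>t'<t. run t' = Send s r (Store (hash sys v) v)"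
    by auto
  obtain r where r: "r \<in> replicas sys" "correct sys r"
    using correct_replica_exists[OF assms(1)] .
  then obtain t' where recv: "run t' = Receive r s (Store (hash sys v) v)"
    using sent assms(2) s(2) unfolding valid_run_def reliable_def by blast
  \<comment> \<open>The bound is \<open>Suc t'\<close> because \<open>store\<close> at a time
    describes the contents just before the event at that time.\<close>
  have "get_returns run p i v"
    if "Suc t' \<le> i" "correct sys p" "run i = Invoke p P" "valid_proof sys run i tag v P" for i p P
  proof (rule get_returns_if_stored[OF assms(1,2) r that(2) _ that(3,4)])
    show "store sys run r u (hash sys v) = Some v" if "i \<le> u" for u
      using that \<open>Suc t' \<le> i\<close> by (intro store_after_receive[OF inj, of run t' r s]) (simp_all add: recv)
  qed
  then have "eventually_available sys run tag v"
    unfolding eventually_available_def by blast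
  with s valid show ?thesis
    by blast
qed

end
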